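(* Let $\mathbb{R}^n_s$ be $\mathbb{R}^n$ with a non-degenerate symmetric bilinear form $\langle\cdot,\cdot\rangle$ of signature $(n-s,s)$, let $G\subset\mathrm{Iso}(\mathbb{R}^n_s)$ be a real Zariski-closed subgroup whose centralizer in $\mathrm{Iso}(\mathbb{R}^n_s)$ acts transitively on $\mathbb{R}^n$, and let $\mathfrak{g}$ be its Lie algebra with the symmetric bilinear form $(\cdot,\cdot)$ induced by the orbit metric. If $X,Y\in\mathfrak{g}$ and $Z=[X,Y]$, then $Z$ is orthogonal with respect to $(\cdot,\cdot)$ to $\mathrm{span}\{X,Y,Z\}$.
   Context: Elements of $\mathfrak{g}$ are written $(A,v)$ (matrices $\begin{pmatrix}A&v\\0&0\end{pmatrix}$). For fixed $p\in\mathbb{R}^n$, the orbit metric form on $\mathfrak{g}$ is $(X,Y)=\langle A_Xp+v_X,\,A_Yp+v_Y\rangle$, i.e. the pullback of $\langle\cdot,\cdot\rangle$ on the orbit $G.p$ via the orbit map; it satisfies $([X,Y],Z)=-(Y,[X,Z])$, and $\mathfrak{g}$ is 2-step nilpotent. *)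

theory Defs
  imports "HOL-Analysis.Analysis"
begin

text \<open>An affine map x |-> M x + b of R^n is represented by the pair (M, b).
  Elements of the Lie algebra of the affine group are pairs (A, v), standing for
  the block matrix [[A, v], [0, 0]].\<close>

type_synonym 'n aff = "(real^'n^'n) \<times> (real^'n)"

definition aff_apply :: "'n::finite aff \<Rightarrow> real^'n \<Rightarrow> real^'n" where
  "aff_apply g x = fst g *v x + snd g"

definition aff_comp :: "'n::finite aff \<Rightarrow> 'n aff \<Rightarrow> 'n aff" where
  "aff_comp g h = (fst g ** fst h, fst g *v snd h + snd g)"

definition aff_id :: "'n::finite aff" where
  "aff_id = (mat 1, 0)"

text \<open>The bilinear form given by a matrix S: <u,w> = u . (S w).\<close>
definition bform :: "real^'n^'n \<Rightarrow> real^'n \<Rightarrow> real^'n \<Rightarrow> real" where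
  "bform S u w = u \<bullet> (S *v w)"

definition nondeg_sym_form :: "real^'n^'n \<Rightarrow> bool" where
  "nondeg_sym_form S \<longleftrightarrow> transpose S = S \<and> invertible S"

text \<open>Iso(R^n_s): affine maps whose linear part preserves the form.\<close>
definition Iso :: "real^'n^'n \<Rightarrow> 'n::finite aff set" where
  "Iso S = {g. transpose (fst g) ** S ** fst g = S}"

definition is_subgroup :: "'n::finite aff set \<Rightarrow> bool" where
  "is_subgroup G \<longleftrightarrow> aff_id \<in> G \<and> (\<forall>g\<in>G. \<forall>h\<in>G. aff_comp g h \<in> G)
     \<and> (\<forall>g\<in>G. \<exists>h\<in>G. aff_comp g h = aff_id \<and> aff_comp h g = aff_id)"

text \<open>Real polynomial functions in the coordinates (matrix entries and translation
  entries) of an affine map.\<close>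
inductive_set poly_fun :: "('n::finite aff \<Rightarrow> real) set" where
  const: "(\<lambda>_. c) \<in> poly_fun"
| coord_mat: "(\<lambda>g. fst g $ i $ j) \<in> poly_fun"
| coord_vec: "(\<lambda>g. snd g $ i) \<in> poly_fun"
| add: "p \<in> poly_fun \<Longrightarrow> q \<in> poly_fun \<Longrightarrow> (\<lambda>g. p g + q g) \<in> poly_fun"
| mult: "p \<in> poly_fun \<Longrightarrow> q \<in> poly_fun \<Longrightarrow> (\<lambda>g. p g * q g) \<in> poly_fun"

definition zariski_closed :: "'n::finite aff set \<Rightarrow> bool" where
  "zariski_closed G \<longleftrightarrow> (\<exists>P \<subseteq> poly_fun. G = {g. \<forall>p\<in>P. p g = 0})"

definition centralizer :: "real^'n^'n \<Rightarrow> 'n::finite aff set \<Rightarrow> 'n aff set" where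
  "centralizer S G = {h \<in> Iso S. \<forall>g\<in>G. aff_comp h g = aff_comp g h}"

definition acts_transitively :: "'n::finite aff set \<Rightarrow> bool" where
  "acts_transitively H \<longleftrightarrow> (\<forall>x y. \<exists>h\<in>H. aff_apply h x = y)"

definition matpow :: "real^'n^'n \<Rightarrow> nat \<Rightarrow> real^'n^'n" where
  "matpow A k = ((\<lambda>M. A ** M) ^^ k) (mat 1)"

definition mexp :: "real^'n^'n \<Rightarrow> real^'n^'n" where
  "mexp A = (\<Sum>k. (1 / fact k :: real) *\<^sub>R matpow A k)"

text \<open>Exponential of the block matrix [[A, v], [0, 0]], which is
  [[exp A, (sum_k A^k/(k+1)!) v], [0, 1]].\<close>
definition aff_exp :: "'n::finite aff \<Rightarrow> 'n aff" where
  "aff_exp X = (mexp (fst X), (\<Sum>k. (1 / fact (Suc k) :: real) *\<^sub>R (matpow (fst X) k *v snd X)))"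

definition lie_algebra :: "'n::finite aff set \<Rightarrow> 'n aff set" where
  "lie_algebra G = {X. \<forall>t::real. aff_exp (t *\<^sub>R X) \<in> G}"

text \<open>Commutator of [[A, v], [0, 0]] and [[B, w], [0, 0]].\<close>
definition lie_bracket :: "'n::finite aff \<Rightarrow> 'n aff \<Rightarrow> 'n aff" where
  "lie_bracket X Y = (fst X ** fst Y - fst Y ** fst X, fst X *v snd Y - fst Y *v snd X)"

text \<open>Orbit metric form at p: (X,Y) = <A_X p + v_X, A_Y p + v_Y>.\<close>
definition orbit_form :: "real^'n^'n \<Rightarrow> real^'n \<Rightarrow> 'n::finite aff \<Rightarrow> 'n aff \<Rightarrow> real" where
  "orbit_form S p X Y = bform S (fst X *v p + snd X) (fst Y *v p + snd Y)"

end

theory Submission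
  imports Defs
begin

text \<open>For X = (A, v) in the Lie algebra, the affine vector field K_X(x) = A x + v is the
  velocity of t \<mapsto> exp(tX) x at t = 0. Since exp(tX) is an isometry, A is skew for the form.
  The centralizer commutes with exp(tX), so its linear parts carry K_X(x) to K_X(h x); as it
  acts transitively by isometries, the function x \<mapsto> \<langle>K_P(x), K_Q(x)\<rangle> is constant on
  the whole space. Differentiating this constant and using skewness and nondegeneracy gives
  A_P K_Q(x) + A_Q K_P(x) = 0. For P = Q this yields A_X^2 = 0, and for the bracket
  K_Z(p) = 2 A_X K_Y(p) = -2 A_Y K_X(p); orthogonality of K_Z(p) to K_X(p), K_Y(p),
  K_Z(p) then follows from skewness.\<close>

lemma matpow_0 [simp]: "matpow A 0 = mat 1"
  by (simp add: matpow_def)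

lemma matpow_Suc [simp]: "matpow A (Suc k) = A ** matpow A k"
  by (simp add: matpow_def)

lemma matpow_scaleR: "matpow (t *\<^sub>R A) k = t ^ k *\<^sub>R matpow (A::real^'n::finite^'n) k"
  by (induction k) (simp_all add: matrix_matrix_mult_def vec_eq_iff sum_distrib_left ac_simps)

lemma onorm_matrix_vector_mult_ge_0 [simp]: "0 \<le> onorm ((*v) (M::real^'n::finite^'m::finite))"
  by (rule onorm_pos_le[OF matrix_vector_mul_bounded_linear])

lemma norm_matrix_vector_mult_le:
  "norm ((M::real^'n::finite^'m::finite) *v x) \<le> onorm ((*v) M) * norm x"
  using onorm[OF matrix_vector_mul_bounded_linear] .

lemma norm_matpow_mult_vec_le:
  "norm (matpow (A::real^'n::finite^'n) k *v x) \<le> onorm ((*v) A) ^ k * norm x"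
proof (induction k arbitrary: x)
  case 0
  then show ?case by simp
next
  case (Suc k)
  have "norm (matpow A (Suc k) *v x) = norm (A *v (matpow A k *v x))"
    by (simp add: matrix_vector_mul_assoc)
  also have "\<dots> \<le> onorm ((*v) A) * norm (matpow A k *v x)"
    by (rule norm_matrix_vector_mult_le)
  also have "\<dots> \<le> onorm ((*v) A) * (onorm ((*v) A) ^ k * norm x)"
    by (rule mult_left_mono[OF Suc.IH]) simp
  finally show ?case by (simp only: power_Suc mult.assoc)
qed

lemma norm_matpow_mult_vec_le_Suc_onorm:
  "norm (matpow (A::real^'n::finite^'n) k *v x) \<le> norm x * (onorm ((*v) A) + 1) ^ k"
proof -
  have "onorm ((*v) A) ^ k \<le> (onorm ((*v) A) + 1) ^ k"
    by (intro power_mono) auto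
  then have "onorm ((*v) A) ^ k * norm x \<le> (onorm ((*v) A) + 1) ^ k * norm x"
    by (rule mult_right_mono) simp
  then show ?thesis
    using norm_matpow_mult_vec_le[of A k x] by (simp add: mult.commute)
qed

lemma norm_matrix_le_onorm:
  "norm (M::real^'n::finite^'n) \<le> real CARD('n) * real CARD('n) * onorm ((*v) M)"
proof -
  have row: "norm (M $ i) \<le> real CARD('n) * onorm ((*v) M)" for i
  proof -
    have "norm (M $ i) \<le> (\<Sum>j\<in>UNIV. \<bar>M $ i $ j\<bar>)"
      by (rule norm_le_l1_cart)
    also have "\<dots> \<le> (\<Sum>j\<in>(UNIV::'n set). onorm ((*v) M))"
    proof (rule sum_mono)
      fix j
      have "\<bar>M $ i $ j\<bar> = \<bar>column j M $ i\<bar>"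
        by (simp add: column_def)
      also have "\<dots> \<le> norm (column j M)"
        by (rule component_le_norm_cart)
      also have "\<dots> \<le> onorm ((*v) M)"
        by (rule norm_column_le_onorm)
      finally show "\<bar>M $ i $ j\<bar> \<le> onorm ((*v) M)" .
    qed
    finally show ?thesis by simp
  qed
  have "norm M \<le> (\<Sum>i\<in>UNIV. norm (M $ i))"
    unfolding norm_vec_def by (rule L2_set_le_sum) simp
  also have "\<dots> \<le> (\<Sum>i\<in>(UNIV::'n set). real CARD('n) * onorm ((*v) M))"
    by (rule sum_mono[OF row])
  finally show ?thesis by (simp add: mult.assoc)
qed

lemma norm_matpow_le:
  "norm (matpow (A::real^'n::finite^'n) k) \<le> real CARD('n) * real CARD('n) * onorm ((*v) A) ^ k"
proof -
  have "onorm ((*v) (matpow A k)) \<le> onorm ((*v) A) ^ k"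
    by (rule onorm_le) (rule norm_matpow_mult_vec_le)
  then have "real CARD('n) * real CARD('n) * onorm ((*v) (matpow A k))
      \<le> real CARD('n) * real CARD('n) * onorm ((*v) A) ^ k"
    by (intro mult_left_mono) auto
  then show ?thesis
    using norm_matrix_le_onorm[of "matpow A k"] by linarith
qed

lemma exp_type_series:
  fixes u :: "nat \<Rightarrow> 'a::banach"
  assumes ub: "\<And>k. norm (u k) \<le> C * b ^ k" and b: "b \<ge> 0"
  shows "summable (\<lambda>k. (t ^ k / fact k) *\<^sub>R u k)"
    and "norm ((\<Sum>k. (t ^ k / fact k) *\<^sub>R u k) - u 0 - t *\<^sub>R u 1)
           \<le> t\<^sup>2 * (C * b\<^sup>2 * exp (\<bar>t\<bar> * b))"
proof -
  define f where "f = (\<lambda>k. (t ^ k / fact k) *\<^sub>R u k)"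
  have C: "C \<ge> 0"
    using ub[of 0] by (metis norm_ge_zero order_trans power_0 mult_1_right)
  have tb: "\<bar>t\<bar> * b \<ge> 0"
    using b by simp
  have es: "(\<lambda>n. (\<bar>t\<bar> * b) ^ n / fact n) sums exp (\<bar>t\<bar> * b)"
    using exp_converges[of "\<bar>t\<bar> * b"] by (simp add: divide_inverse_commute mult.commute)
  have nf: "norm (f k) \<le> C * ((\<bar>t\<bar> * b) ^ k / fact k)" for k
  proof -
    have "norm (f k) = (\<bar>t\<bar> ^ k / fact k) * norm (u k)"
      by (simp add: f_def power_abs)
    also have "\<dots> \<le> (\<bar>t\<bar> ^ k / fact k) * (C * b ^ k)"
      by (rule mult_left_mono[OF ub]) simp
    also have "\<dots> = C * ((\<bar>t\<bar> * b) ^ k / fact k)"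
      by (simp add: power_mult_distrib)
    finally show ?thesis .
  qed
  have "summable (\<lambda>k. C * ((\<bar>t\<bar> * b) ^ k / fact k))"
    using es by (intro summable_mult) (simp add: sums_summable)
  then show sf: "summable (\<lambda>k. (t ^ k / fact k) *\<^sub>R u k)"
    unfolding f_def[symmetric] by (rule summable_comparison_test'[OF _ nf])
  have tail: "norm (f (n + 2)) \<le> t\<^sup>2 * (C * b\<^sup>2) * ((\<bar>t\<bar> * b) ^ n / fact n)" for n
  proof -
    have "norm (f (n + 2)) \<le> C * ((\<bar>t\<bar> * b) ^ (n + 2) / fact (n + 2))"
      by (rule nf)
    also have "\<dots> \<le> C * ((\<bar>t\<bar> * b) ^ (n + 2) / fact n)"
      by (intro mult_left_mono divide_left_mono fact_mono) (simp_all add: C tb)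
    also have "\<dots> = t\<^sup>2 * (C * b\<^sup>2) * ((\<bar>t\<bar> * b) ^ n / fact n)"
      by (simp add: power_add power_mult_distrib power2_eq_square)
    finally show ?thesis .
  qed
  have "norm (\<Sum>n. f (n + 2)) \<le> (\<Sum>n. t\<^sup>2 * (C * b\<^sup>2) * ((\<bar>t\<bar> * b) ^ n / fact n))"
    by (rule norm_suminf_le[OF tail]) (intro summable_mult sums_summable[OF es])
  also have "\<dots> = t\<^sup>2 * (C * b\<^sup>2) * exp (\<bar>t\<bar> * b)"
    using sums_mult[OF es, of "t\<^sup>2 * (C * b\<^sup>2)"] by (simp add: sums_iff)
  finally have "norm (\<Sum>n. f (n + 2)) \<le> t\<^sup>2 * (C * b\<^sup>2) * exp (\<bar>t\<bar> * b)" .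
  moreover have "suminf f = (\<Sum>n. f (n + 2)) + (u 0 + t *\<^sub>R u 1)"
    using suminf_split_initial_segment[of f 2] sf by (simp add: f_def numeral_2_eq_2)
  ultimately show "norm ((\<Sum>k. (t ^ k / fact k) *\<^sub>R u k) - u 0 - t *\<^sub>R u 1)
      \<le> t\<^sup>2 * (C * b\<^sup>2 * exp (\<bar>t\<bar> * b))"
    by (simp add: f_def mult.assoc)
qed

lemma tendsto_exp_type_series_diff_quotient:
  fixes u :: "nat \<Rightarrow> 'a::banach"
  assumes ub: "\<And>k. norm (u k) \<le> C * b ^ k" and b: "b \<ge> 0"
  shows "((\<lambda>t. ((\<Sum>k. (t ^ k / fact k) *\<^sub>R u k) - u 0) /\<^sub>R t) \<longlongrightarrow> u 1) (at 0)"
proof -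
  define K where "K t = C * b\<^sup>2 * exp (\<bar>t\<bar> * b)" for t :: real
  have "\<forall>\<^sub>F t in at 0. norm (((\<Sum>k. (t ^ k / fact k) *\<^sub>R u k) - u 0) /\<^sub>R t - u 1) \<le> \<bar>t\<bar> * K t"
    unfolding eventually_at_filter
  proof (rule always_eventually, intro allI impI)
    fix t :: real
    assume t: "t \<noteq> 0"
    let ?R = "(\<Sum>k. (t ^ k / fact k) *\<^sub>R u k) - u 0 - t *\<^sub>R u 1"
    have "((\<Sum>k. (t ^ k / fact k) *\<^sub>R u k) - u 0) /\<^sub>R t - u 1 = ?R /\<^sub>R t"
      using t by (simp add: scaleR_diff_right)
    moreover have "norm (?R /\<^sub>R t) \<le> t\<^sup>2 * K t / \<bar>t\<bar>"
      using divide_right_mono[OF exp_type_series(2)[OF ub b, of t] abs_ge_zero[of t]]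
      by (simp add: K_def divide_inverse_commute)
    moreover have "t\<^sup>2 * K t / \<bar>t\<bar> = \<bar>t\<bar> * K t"
      using t by (simp add: power2_eq_square abs_mult_self_eq[symmetric, of t] del: abs_mult_self_eq)
    ultimately show "norm (((\<Sum>k. (t ^ k / fact k) *\<^sub>R u k) - u 0) /\<^sub>R t - u 1) \<le> \<bar>t\<bar> * K t"
      by simp
  qed
  moreover have "((\<lambda>t. \<bar>t\<bar> * K t) \<longlongrightarrow> 0) (at 0)"
    unfolding K_def by (rule tendsto_eq_intros refl | simp)+
  ultimately show ?thesis
    by (rule Lim_null_comparison[THEN LIM_zero_cancel])
qed

lemma bounded_linear_matrix_vector_mult_left:
  "bounded_linear (\<lambda>M::real^'n::finite^'m::finite. M *v x)"
proof -
  have "linear (\<lambda>M::real^'n::finite^'m::finite. M *v x)"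
    by (rule linearI) (simp_all add: matrix_vector_mult_add_rdistrib scaleR_matrix_vector_assoc)
  then show ?thesis
    using linear_conv_bounded_linear by blast
qed

lemma mexp_scaleR_mult_vec:
  "mexp (t *\<^sub>R A) *v x = (\<Sum>k. (t ^ k / fact k) *\<^sub>R (matpow (A::real^'n::finite^'n) k *v x))"
proof -
  have "summable (\<lambda>k. (t ^ k / fact k) *\<^sub>R matpow A k)"
    by (rule exp_type_series(1)[where C = "real CARD('n) * real CARD('n)" and b = "onorm ((*v) A)"])
      (simp_all add: norm_matpow_le)
  moreover have "mexp (t *\<^sub>R A) = (\<Sum>k. (t ^ k / fact k) *\<^sub>R matpow A k)"
    by (simp add: mexp_def matpow_scaleR)
  ultimately show ?thesis
    by (simp add: bounded_linear.suminf[OF bounded_linear_matrix_vector_mult_left]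
        scaleR_matrix_vector_assoc)
qed

lemma norm_matpow_pred_mult_vec_le:
  "norm (case k of 0 \<Rightarrow> 0 | Suc j \<Rightarrow> matpow (A::real^'n::finite^'n) j *v v)
     \<le> norm v * (onorm ((*v) A) + 1) ^ k"
proof (cases k)
  case (Suc j)
  have "norm (matpow A j *v v) \<le> norm v * (onorm ((*v) A) + 1) ^ j"
    by (rule norm_matpow_mult_vec_le_Suc_onorm)
  also have "\<dots> \<le> norm v * (onorm ((*v) A) + 1) ^ Suc j"
    by (intro mult_left_mono power_increasing) auto
  finally show ?thesis
    using Suc by simp
qed simp

lemma snd_aff_exp_scaleR:
  "snd (aff_exp (t *\<^sub>R A, t *\<^sub>R v)) =
     (\<Sum>k. (t ^ k / fact k) *\<^sub>R (case k of 0 \<Rightarrow> 0 | Suc j \<Rightarrow> matpow (A::real^'n::finite^'n) j *v v))"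
proof -
  define w where "w k = (case k of 0 \<Rightarrow> 0 | Suc j \<Rightarrow> matpow A j *v v)" for k
  have "summable (\<lambda>k. (t ^ k / fact k) *\<^sub>R w k)"
    unfolding w_def
    by (rule exp_type_series(1)[OF norm_matpow_pred_mult_vec_le]) simp
  moreover have "snd (aff_exp (t *\<^sub>R A, t *\<^sub>R v)) = (\<Sum>k. (t ^ Suc k / fact (Suc k)) *\<^sub>R w (Suc k))"
    by (simp add: aff_exp_def w_def matpow_scaleR scaleR_matrix_vector_assoc[symmetric]
        matrix_vector_mult_scaleR mult.commute)
  ultimately show ?thesis
    using suminf_split_head[of "\<lambda>k. (t ^ k / fact k) *\<^sub>R w k"] by (simp add: w_def)
qed

lemma aff_apply_aff_exp_scaleR:
  "aff_apply (aff_exp (t *\<^sub>R A, t *\<^sub>R v)) x =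
     (\<Sum>k. (t ^ k / fact k) *\<^sub>R (matpow (A::real^'n::finite^'n) k *v x
        + (case k of 0 \<Rightarrow> 0 | Suc j \<Rightarrow> matpow A j *v v)))"
proof -
  have "summable (\<lambda>k. (t ^ k / fact k) *\<^sub>R (matpow A k *v x))"
    by (rule exp_type_series(1)[OF norm_matpow_mult_vec_le_Suc_onorm]) simp
  moreover have "summable (\<lambda>k. (t ^ k / fact k) *\<^sub>R (case k of 0 \<Rightarrow> 0 | Suc j \<Rightarrow> matpow A j *v v))"
    by (rule exp_type_series(1)[OF norm_matpow_pred_mult_vec_le]) simp
  moreover have "aff_apply (aff_exp (t *\<^sub>R A, t *\<^sub>R v)) x =
      (\<Sum>k. (t ^ k / fact k) *\<^sub>R (matpow A k *v x))
      + (\<Sum>k. (t ^ k / fact k) *\<^sub>R (case k of 0 \<Rightarrow> 0 | Suc j \<Rightarrow> matpow A j *v v))"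
    by (simp only: aff_apply_def snd_aff_exp_scaleR mexp_scaleR_mult_vec[symmetric])
      (simp add: aff_exp_def)
  ultimately show ?thesis
    by (simp add: suminf_add scaleR_right_distrib)
qed

definition killing_field :: "'n::finite aff \<Rightarrow> real^'n \<Rightarrow> real^'n" where
  "killing_field X x = fst X *v x + snd X"

lemma tendsto_aff_exp_diff_quotient:
  "((\<lambda>t. (aff_apply (aff_exp (t *\<^sub>R X)) x - x) /\<^sub>R t) \<longlongrightarrow> killing_field X x) (at 0)"
proof -
  obtain A v where X: "X = (A, v)"
    by fastforce
  define u where "u k = matpow A k *v x + (case k of 0 \<Rightarrow> 0 | Suc j \<Rightarrow> matpow A j *v v)" for k
  have "norm (u k) \<le> (norm x + norm v) * (onorm ((*v) A) + 1) ^ k" for k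
    using norm_triangle_le[OF add_mono[OF norm_matpow_mult_vec_le_Suc_onorm norm_matpow_pred_mult_vec_le]]
    by (simp add: u_def distrib_right)
  then have "((\<lambda>t. ((\<Sum>k. (t ^ k / fact k) *\<^sub>R u k) - u 0) /\<^sub>R t) \<longlongrightarrow> u 1) (at 0)"
    by (rule tendsto_exp_type_series_diff_quotient) simp
  then show ?thesis
    by (simp add: X u_def killing_field_def aff_apply_aff_exp_scaleR)
qed

lemma tendsto_aff_exp_linear_diff_quotient:
  "((\<lambda>t. (fst (aff_exp (t *\<^sub>R X)) *v u - u) /\<^sub>R t) \<longlongrightarrow> fst X *v u) (at 0)"
proof -
  have "((\<lambda>t. (aff_apply (aff_exp (t *\<^sub>R X)) u - u) /\<^sub>R t - (aff_apply (aff_exp (t *\<^sub>R X)) 0 - 0) /\<^sub>R t)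
      \<longlongrightarrow> killing_field X u - killing_field X 0) (at 0)"
    by (intro tendsto_diff tendsto_aff_exp_diff_quotient)
  then show ?thesis
    by (simp add: aff_apply_def killing_field_def scaleR_diff_right[symmetric])
qed

lemma killing_field_add: "killing_field X (x + w) = killing_field X x + fst X *v w"
  by (simp add: killing_field_def matrix_vector_right_distrib algebra_simps)

lemma killing_field_diff: "killing_field X (x - w) = killing_field X x - fst X *v w"
  by (simp add: killing_field_def matrix_vector_mult_diff_distrib algebra_simps)

lemma killing_field_lie_bracket:
  "killing_field (lie_bracket X Y) p = fst X *v killing_field Y p - fst Y *v killing_field X p"
  by (simp add: killing_field_def lie_bracket_def matrix_vector_mult_diff_rdistrib
      matrix_vector_mul_assoc[symmetric] matrix_vector_right_distrib matrix_vector_mult_diff_distrib)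

lemma linear_killing_field: "linear (\<lambda>X. killing_field X p)"
  by (rule linearI)
    (simp_all add: killing_field_def matrix_vector_mult_add_rdistrib scaleR_matrix_vector_assoc
      scaleR_right_distrib)

lemma orbit_form_killing_field: "orbit_form S p X Y = bform S (killing_field X p) (killing_field Y p)"
  by (simp add: orbit_form_def killing_field_def)

lemma bform_add_left: "bform S (a + b) c = bform S a c + bform S b c"
  by (simp add: bform_def inner_add_left)

lemma bform_add_right: "bform S a (b + c) = bform S a b + bform S a c"
  by (simp add: bform_def inner_add_right matrix_vector_right_distrib)

lemma bform_diff_left: "bform S (a - b) c = bform S a c - bform S b c"
  by (simp add: bform_def inner_diff_left)

lemma bform_diff_right: "bform S a (b - c) = bform S a b - bform S a c"
  by (simp add: bform_def inner_diff_right matrix_vector_mult_diff_distrib)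

lemma bform_scaleR_left: "bform S (r *\<^sub>R a) b = r * bform S a b"
  by (simp add: bform_def)

lemma linear_bform_right: "linear (bform S a)"
  by (rule linearI) (simp_all add: bform_def inner_add_right matrix_vector_right_distrib
      matrix_vector_mult_scaleR)

lemma inner_matrix_vector_mult_left:
  "((M::real^'n::finite^'m::finite) *v u) \<bullet> y = u \<bullet> (transpose M *v y)"
  by (metis dot_lmul_matrix inner_commute transpose_matrix_vector)

lemma bform_commute: "transpose S = S \<Longrightarrow> bform S a b = bform S b a"
  unfolding bform_def by (metis inner_matrix_vector_mult_left inner_commute)

lemma bform_Iso:
  assumes "g \<in> Iso S"
  shows "bform S (fst g *v u) (fst g *v w) = bform S u w"
proof -
  have "bform S (fst g *v u) (fst g *v w) = u \<bullet> ((transpose (fst g) ** S ** fst g) *v w)"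
    unfolding bform_def inner_matrix_vector_mult_left
    by (simp add: matrix_vector_mul_assoc matrix_mul_assoc)
  then show ?thesis
    using assms by (simp add: Iso_def bform_def)
qed

lemma tendsto_bform [tendsto_intros]:
  assumes "(f \<longlongrightarrow> a) F" "(g \<longlongrightarrow> c) F"
  shows "((\<lambda>t. bform S (f t) (g t)) \<longlongrightarrow> bform S a c) F"
  unfolding bform_def
  by (intro tendsto_inner assms bounded_linear.tendsto[OF matrix_vector_mul_bounded_linear])

lemma bform_first_variation_eq_0:
  fixes Lu Lw :: "real \<Rightarrow> real^'n::finite"
  assumes "(Lu \<longlongrightarrow> a) (at 0)" "(Lw \<longlongrightarrow> c) (at 0)"
    and inv: "\<And>t. t \<noteq> 0 \<Longrightarrow> bform S (u + t *\<^sub>R Lu t) (w + t *\<^sub>R Lw t) = bform S u w"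
  shows "bform S a w + bform S u c = 0"
proof -
  define F where "F t = bform S (Lu t) w + bform S u (Lw t) + t * bform S (Lu t) (Lw t)" for t
  have "(F \<longlongrightarrow> bform S a w + bform S u c + 0 * bform S a c) (at 0)"
    unfolding F_def by (intro tendsto_intros assms)
  moreover have "(F \<longlongrightarrow> 0) (at 0)"
  proof (rule tendsto_eventually, unfold eventually_at_filter, rule always_eventually, intro allI impI)
    fix t :: real
    assume t: "t \<noteq> 0"
    have "bform S (u + t *\<^sub>R Lu t) (w + t *\<^sub>R Lw t) = bform S u w + t * F t"
      by (simp add: F_def bform_def inner_add_left inner_add_right matrix_vector_right_distrib
          matrix_vector_mult_scaleR algebra_simps)
    then show "F t = 0"
      using inv[OF t] t by simp
  qed
  ultimately show ?thesis
    using tendsto_unique[OF at_neq_bot] by fastforce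
qed

lemma lie_algebra_skew:
  assumes "X \<in> lie_algebra G" and "G \<subseteq> Iso S"
  shows "bform S (fst X *v u) w + bform S u (fst X *v w) = 0"
proof (rule bform_first_variation_eq_0[OF tendsto_aff_exp_linear_diff_quotient
      tendsto_aff_exp_linear_diff_quotient])
  fix t :: real
  assume t: "t \<noteq> 0"
  let ?M = "fst (aff_exp (t *\<^sub>R X))"
  have "aff_exp (t *\<^sub>R X) \<in> Iso S"
    using assms by (auto simp: lie_algebra_def)
  then have "bform S (?M *v u) (?M *v w) = bform S u w"
    by (rule bform_Iso)
  then show "bform S (u + t *\<^sub>R ((?M *v u - u) /\<^sub>R t)) (w + t *\<^sub>R ((?M *v w - w) /\<^sub>R t)) = bform S u w"
    using t by simp
qed

lemma aff_apply_aff_comp: "aff_apply (aff_comp g h) x = aff_apply g (aff_apply h x)"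
  by (simp add: aff_apply_def aff_comp_def matrix_vector_mul_assoc matrix_vector_right_distrib add.assoc)

lemma aff_apply_diff: "aff_apply h a - aff_apply h b = fst h *v (a - b)"
  by (simp add: aff_apply_def matrix_vector_mult_diff_distrib)

lemma centralizer_killing_field:
  assumes X: "X \<in> lie_algebra G" and h: "h \<in> centralizer S G"
  shows "fst h *v killing_field X x = killing_field X (aff_apply h x)"
proof -
  define D where "D y t = (aff_apply (aff_exp (t *\<^sub>R X)) y - y) /\<^sub>R t" for y t
  have "fst h *v D x t = D (aff_apply h x) t" for t
  proof -
    have "aff_comp h (aff_exp (t *\<^sub>R X)) = aff_comp (aff_exp (t *\<^sub>R X)) h"
      using h X by (simp add: centralizer_def lie_algebra_def)
    then have "aff_apply h (aff_apply (aff_exp (t *\<^sub>R X)) x) = aff_apply (aff_exp (t *\<^sub>R X)) (aff_apply h x)"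
      by (metis aff_apply_aff_comp)
    then show ?thesis
      by (metis D_def aff_apply_diff matrix_vector_mult_scaleR)
  qed
  moreover have "((\<lambda>t. fst h *v D x t) \<longlongrightarrow> fst h *v killing_field X x) (at 0)"
    unfolding D_def
    by (intro bounded_linear.tendsto[OF matrix_vector_mul_bounded_linear] tendsto_aff_exp_diff_quotient)
  moreover have "(D (aff_apply h x) \<longlongrightarrow> killing_field X (aff_apply h x)) (at 0)"
    unfolding D_def by (rule tendsto_aff_exp_diff_quotient)
  ultimately show ?thesis
    using tendsto_unique[OF at_neq_bot] by fastforce
qed

lemma bform_killing_field_constant:
  assumes P: "P \<in> lie_algebra G" and Q: "Q \<in> lie_algebra G"
    and tr: "acts_transitively (centralizer S G)"
  shows "bform S (killing_field P y) (killing_field Q y) = bform S (killing_field P x) (killing_field Q x)"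
proof -
  obtain h where h: "h \<in> centralizer S G" and hx: "aff_apply h x = y"
    using tr unfolding acts_transitively_def by blast
  have "bform S (killing_field P y) (killing_field Q y)
      = bform S (fst h *v killing_field P x) (fst h *v killing_field Q x)"
    using centralizer_killing_field[OF P h] centralizer_killing_field[OF Q h] hx by simp
  also have "\<dots> = bform S (killing_field P x) (killing_field Q x)"
    using h by (intro bform_Iso) (simp add: centralizer_def)
  finally show ?thesis .
qed

lemma bform_killing_field_polarize:
  assumes P: "P \<in> lie_algebra G" and Q: "Q \<in> lie_algebra G"
    and tr: "acts_transitively (centralizer S G)"
  shows "bform S (fst P *v w) (killing_field Q x) + bform S (killing_field P x) (fst Q *v w) = 0"
proof -
  have "bform S (killing_field P (x + w)) (killing_field Q (x + w))
      = bform S (killing_field P (x - w)) (killing_field Q (x - w))"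
    using bform_killing_field_constant[OF P Q tr, of "x + w" x]
      bform_killing_field_constant[OF P Q tr, of "x - w" x]
    by simp
  then show ?thesis
    unfolding killing_field_add killing_field_diff bform_add_left bform_add_right
      bform_diff_left bform_diff_right
    by simp
qed

lemma nondeg_sym_form_eq_0:
  assumes "nondeg_sym_form S" and "\<And>w. bform S w z = 0"
  shows "z = 0"
proof -
  have "S *v z = 0"
    using assms(2)[of "S *v z"] by (simp add: bform_def)
  moreover obtain B where "B ** S = mat 1"
    using assms(1) unfolding nondeg_sym_form_def invertible_def by blast
  ultimately show ?thesis
    by (metis matrix_vector_mul_assoc matrix_vector_mul_lid matrix_vector_mult_0_right)
qed

lemma lie_algebra_killing_field_relation:
  assumes P: "P \<in> lie_algebra G" and Q: "Q \<in> lie_algebra G"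
    and tr: "acts_transitively (centralizer S G)" and GI: "G \<subseteq> Iso S"
    and nd: "nondeg_sym_form S"
  shows "fst P *v killing_field Q x + fst Q *v killing_field P x = 0"
proof (rule nondeg_sym_form_eq_0[OF nd])
  fix w
  have "bform S (killing_field P x) (fst Q *v w) = bform S (fst Q *v w) (killing_field P x)"
    using nd by (intro bform_commute) (simp add: nondeg_sym_form_def)
  then show "bform S w (fst P *v killing_field Q x + fst Q *v killing_field P x) = 0"
    using bform_killing_field_polarize[OF P Q tr, of w x]
      lie_algebra_skew[OF P GI, of w "killing_field Q x"] lie_algebra_skew[OF Q GI, of w "killing_field P x"]
    unfolding bform_add_right by linarith
qed

lemma orbit_form_lie_bracket_generators:
  assumes nd: "nondeg_sym_form S" and GI: "G \<subseteq> Iso S"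
    and tr: "acts_transitively (centralizer S G)"
    and X: "X \<in> lie_algebra G" and Y: "Y \<in> lie_algebra G"
  shows "orbit_form S p (lie_bracket X Y) X = 0"
    and "orbit_form S p (lie_bracket X Y) Y = 0"
    and "orbit_form S p (lie_bracket X Y) (lie_bracket X Y) = 0"
proof -
  define Z where "Z = killing_field (lie_bracket X Y) p"
  note rel = lie_algebra_killing_field_relation[OF _ _ tr GI nd]
  have skew_X: "bform S (fst X *v u) w = - bform S u (fst X *v w)" for u w
    using lie_algebra_skew[OF X GI, of u w] by linarith
  have skew_Y: "bform S (fst Y *v u) w = - bform S u (fst Y *v w)" for u w
    using lie_algebra_skew[OF Y GI, of u w] by linarith
  have XX: "fst X *v killing_field X x = 0" and YY: "fst Y *v killing_field Y x = 0" for x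
    using rel[OF X X, of x] rel[OF Y Y, of x] by (metis scaleR_2 scaleR_eq_0_iff zero_neq_numeral)+
  have X_square: "fst X *v (fst X *v y) = 0" for y
    using XX[of y] XX[of 0] killing_field_add[of X 0 y] by (simp add: matrix_vector_right_distrib)
  have YX: "fst Y *v killing_field X p = - (fst X *v killing_field Y p)"
    using rel[OF X Y, of p] by (simp add: eq_neg_iff_add_eq_0 add.commute)
  have Z_X: "Z = 2 *\<^sub>R (fst X *v killing_field Y p)"
    unfolding Z_def killing_field_lie_bracket YX by (simp add: scaleR_2)
  have Z_Y: "Z = - 2 *\<^sub>R (fst Y *v killing_field X p)"
    unfolding Z_X YX by simp
  show "orbit_form S p (lie_bracket X Y) X = 0"
    unfolding orbit_form_killing_field Z_def[symmetric] Z_X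
    by (simp only: bform_scaleR_left skew_X XX) (simp add: bform_def)
  show "orbit_form S p (lie_bracket X Y) Y = 0"
    unfolding orbit_form_killing_field Z_def[symmetric] Z_Y
    by (simp only: bform_scaleR_left skew_Y YY) (simp add: bform_def)
  have XZ: "fst X *v Z = 0"
    unfolding Z_X by (simp add: matrix_vector_mult_scaleR X_square)
  have "bform S Z Z = 2 * bform S (fst X *v killing_field Y p) Z"
    by (subst (1) Z_X) (rule bform_scaleR_left)
  also have "\<dots> = 0"
    by (simp only: skew_X XZ) (simp add: bform_def)
  finally show "orbit_form S p (lie_bracket X Y) (lie_bracket X Y) = 0"
    unfolding orbit_form_killing_field Z_def[symmetric] .
qed

theorem lemma4p9:
  fixes S :: "real^'n::finite^'n" and G :: "'n aff set" and p :: "real^'n"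
    and X Y :: "'n aff"
  assumes "nondeg_sym_form S"
    and "G \<subseteq> Iso S" and "is_subgroup G" and "zariski_closed G"
    and "acts_transitively (centralizer S G)"
    and "X \<in> lie_algebra G" and "Y \<in> lie_algebra G"
  shows "\<forall>W \<in> span {X, Y, lie_bracket X Y}. orbit_form S p (lie_bracket X Y) W = 0"
proof -
  let ?V = "{W. orbit_form S p (lie_bracket X Y) W = 0}"
  have "linear (\<lambda>W. orbit_form S p (lie_bracket X Y) W)"
    unfolding orbit_form_killing_field
    by (rule linear_compose[OF linear_killing_field linear_bform_right, unfolded o_def])
  then have "subspace ?V"
    unfolding subspace_def by (simp add: linear_0 linear_add linear_scale)
  moreover have "{X, Y, lie_bracket X Y} \<subseteq> ?V"
    using orbit_form_lie_bracket_generators[OF assms(1,2,5,6,7)] by simp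
  ultimately show ?thesis
    using span_minimal by blast
qed

end
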